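(* Let $\mathcal H$ be a hereditary class. Let $X$ be a graph on $n_0$ vertices with a Hamiltonian path, and suppose that $\mathsf{FS}(X,Y)$ is connected for every $Y\in\mathcal H$ on $n_0$ vertices. If $\widetilde X$ is a prolongation of $X$ with $n$ vertices, then $\mathsf{FS}(\widetilde X,\widetilde Y)$ is connected for every $\widetilde Y\in\mathcal H$ on $n$ vertices.
   Context: All graphs are finite and simple. For graphs $X,Y$ with $|V(X)|=|V(Y)|$, the friends-and-strangers graph $\mathsf{FS}(X,Y)$ has as vertices all bijections $\sigma\colon V(X)\to V(Y)$; two bijections $\sigma,\sigma'$ are adjacent iff there is an edge $\{a,b\}\in E(X)$ with $\{\sigma(a),\sigma(b)\}\in E(Y)$, $\sigma(a)=\sigma'(b)$, $\sigma(b)=\sigma'(a)$, and $\sigma(c)=\sigma'(c)$ for all $c\in V(X)\setminus\{a,b\}$. A hereditary class is a collection of (isomorphism types of) graphs closed under taking induced subgraphs. A Hamiltonian path in a graph $G$ on $n$ vertices is a subgraph of $G$ isomorphic to the path graph on $n$ vertices. If $X$ is a graph with a Hamiltonian path, a prolongation of $X$ is a graph $\widetilde X$ such that: (1) $\widetilde X$ contains a (not necessarily induced) subgraph $X^\#$ that is isomorphic to $X$; and (2) $\widetilde X$ contains a Hamiltonian path that itself contains a Hamiltonian path of $X^\#$.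
   Formalization: The formal theorem additionally assumes that X has at least two vertices (n_0 ≥ 2); for n_0 = 1 the claim fails, e.g. for all graphs, X = K_1, prolongation K_2, and the edgeless graph on two vertices. *)

theory Defs
  imports "HOL-Library.FuncSet" "Graph_Theory.Graph_Theory"
begin

text \<open>A finite simple graph is a \<^locale>\<open>pair_graph\<close>: an undirected edge \<open>{a, b}\<close> is represented by
  the two arcs \<open>(a, b)\<close> and \<open>(b, a)\<close>.\<close>

text \<open>Bijections are taken in \<open>pverts X \<rightarrow>\<^sub>E pverts Y\<close>, i.e. they are \<^const>\<open>undefined\<close> outside
  \<open>pverts X\<close>, so that distinct HOL functions are distinct bijections.\<close>

definition bijections :: "'a set \<Rightarrow> 'b set \<Rightarrow> ('a \<Rightarrow> 'b) set" where
  "bijections A B = {\<sigma> \<in> A \<rightarrow>\<^sub>E B. bij_betw \<sigma> A B}"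

definition FS :: "'a pair_pre_digraph \<Rightarrow> 'b pair_pre_digraph \<Rightarrow> ('a \<Rightarrow> 'b) pair_pre_digraph" where
  "FS X Y = \<lparr> pverts = bijections (pverts X) (pverts Y),
     parcs = {(\<sigma>, \<sigma>'). \<sigma> \<in> bijections (pverts X) (pverts Y) \<and> \<sigma>' \<in> bijections (pverts X) (pverts Y) \<and>
       (\<exists>a b. (a, b) \<in> parcs X \<and> (\<sigma> a, \<sigma> b) \<in> parcs Y \<and> \<sigma> a = \<sigma>' b \<and> \<sigma> b = \<sigma>' a \<and>
          (\<forall>c \<in> pverts X - {a, b}. \<sigma> c = \<sigma>' c))} \<rparr>"

text \<open>A class of isomorphism types is represented by an isomorphism-closed set of graphs whose
  vertices are drawn from the type \<^typ>\<open>'b\<close>; the type \<^typ>\<open>nat\<close> already realises all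
  isomorphism types of finite graphs.\<close>

definition hereditary_class :: "'b pair_pre_digraph set \<Rightarrow> bool" where
  "hereditary_class \<H> \<longleftrightarrow>
     (\<forall>G \<in> \<H>. pair_graph G) \<and>
     (\<forall>G \<in> \<H>. \<forall>K. pair_graph K \<and> digraph_iso (with_proj G) (with_proj K) \<longrightarrow> K \<in> \<H>) \<and>
     (\<forall>G \<in> \<H>. \<forall>K. induced_subgraph (with_proj K) (with_proj G) \<longrightarrow> K \<in> \<H>)"

definition path_graph :: "nat \<Rightarrow> nat pair_pre_digraph" where
  "path_graph n = \<lparr> pverts = {..<n},
     parcs = {(i, j). i < n \<and> j < n \<and> (j = Suc i \<or> i = Suc j)} \<rparr>"

definition hamiltonian_path :: "'a pair_pre_digraph \<Rightarrow> 'a pair_pre_digraph \<Rightarrow> bool" where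
  "hamiltonian_path P G \<longleftrightarrow> subgraph (with_proj P) (with_proj G) \<and>
     digraph_iso (with_proj P) (with_proj (path_graph (card (pverts G))))"

text \<open>Degenerate case: every nonempty graph with a Hamiltonian path is a prolongation of the
  one-vertex graph \<open>K\<close>, while \<open>FS K Y\<close> is connected for every one-vertex \<open>Y\<close>. So connectedness
  does not pass from \<open>X\<close> to a prolongation of \<open>X\<close> unless \<open>X\<close> has at least two vertices.\<close>

definition prolongation :: "'a pair_pre_digraph \<Rightarrow> 'c pair_pre_digraph \<Rightarrow> bool" where
  "prolongation X Xt \<longleftrightarrow> pair_graph Xt \<and>
     (\<exists>Xs. subgraph (with_proj Xs) (with_proj Xt) \<and> digraph_iso (with_proj X) (with_proj Xs) \<and>
       (\<exists>P Q. hamiltonian_path P Xt \<and> hamiltonian_path Q Xs \<and> subgraph (with_proj Q) (with_proj P)))"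

end

theory Submission
  imports Defs "HOL-Combinatorics.Transposition"
begin

text \<open>
  Think of \<open>V(X)\<close> as positions, of \<open>V(Y)\<close> as people, and of an arc of \<open>FS X Y\<close> as two friends
  on adjacent positions changing places. The copy of \<open>X\<close> in \<open>Xt\<close> occupies a set \<open>S\<close> of
  positions, and a Hamiltonian path of \<open>Xt\<close> lets \<open>S\<close> grow by one position at a time until it is
  all of \<open>V(Xt)\<close>: as long as \<open>S\<close> is not everything, some arc of the path leaves \<open>S\<close>
  (\<open>hamiltonian_path_imp_crossing_arc\<close>). The property carried along is that
  \<open>FS (Xt[S]) Y\<close> is connected for all \<open>Y\<close> in the class that have \<open>|S|\<close> vertices.

  The growth step (\<open>FS_all_reachable_insert_position\<close>) adds a position \<open>w\<close> next to some \<open>v\<close> in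
  \<open>S\<close>. Let \<open>Y\<close> have \<open>|S| + 1\<close> vertices. While a person \<open>y\<close> waits at \<open>w\<close>, the others
  form the graph \<open>Y - y\<close>, which belongs to the class by heredity, so they can be rearranged on \<open>S\<close>
  in every way; hence only the occupant of \<open>w\<close> matters. A friend of \<open>y\<close> can be brought to \<open>v\<close>
  and exchanged with \<open>y\<close>, so the occupant of \<open>w\<close> can be replaced by any person of the same
  component of \<open>Y\<close>.

  It remains to see that \<open>Y\<close> is connected (\<open>connected_if_induced_FS_reachable\<close>). Whoever occupies a
  fixed position changes only along arcs of \<open>Y\<close>, so connectedness of a friends-and-strangers graph
  forces the graph of people to be connected. By heredity this applies to every subgraph of \<open>Y\<close>
  induced by \<open>|S|\<close> vertices, and since \<open>|S| \<ge> 2\<close>, any two people lie in one of these.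
\<close>

section \<open>Bijections and walks in a friends-and-strangers graph\<close>

lemma bijectionsD:
  assumes "\<sigma> \<in> bijections A B"
  shows "bij_betw \<sigma> A B" "\<And>x. x \<notin> A \<Longrightarrow> \<sigma> x = undefined"
  using assms by (auto simp: bijections_def PiE_iff extensional_def)

lemma bijectionsI:
  assumes "bij_betw \<sigma> A B" "\<And>x. x \<notin> A \<Longrightarrow> \<sigma> x = undefined"
  shows "\<sigma> \<in> bijections A B"
  using assms by (auto simp: bijections_def PiE_iff extensional_def bij_betw_apply)

lemma bijections_nonempty:
  assumes "finite A" "finite B" "card A = card B"
  shows "bijections A B \<noteq> {}"
proof -
  obtain f where "bij_betw f A B"
    using finite_same_card_bij[OF assms] by blast
  then have "bij_betw (restrict f A) A B"
    by (simp add: bij_betw_restrict_eq)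
  then have "restrict f A \<in> bijections A B"
    by (intro bijectionsI) auto
  then show ?thesis by blast
qed

lemma bijections_comp_transpose:
  assumes "\<sigma> \<in> bijections A B" "a \<in> A" "b \<in> A"
  shows "\<sigma> \<circ> transpose a b \<in> bijections A B"
proof (rule bijectionsI)
  have "bij_betw (transpose a b) A A"
    using assms(2,3) by (simp add: bij_betw_transpose_iff)
  then show "bij_betw (\<sigma> \<circ> transpose a b) A B"
    using bijectionsD(1)[OF assms(1)] by (rule bij_betw_trans)
  show "(\<sigma> \<circ> transpose a b) x = undefined" if "x \<notin> A" for x
    using that assms(2,3) bijectionsD(2)[OF assms(1)] by (auto simp: transpose_def)
qed

lemma FS_arc_iff:
  "(\<sigma>, \<tau>) \<in> parcs (FS X Y) \<longleftrightarrow>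
     \<sigma> \<in> bijections (pverts X) (pverts Y) \<and> \<tau> \<in> bijections (pverts X) (pverts Y) \<and>
     (\<exists>a b. (a, b) \<in> parcs X \<and> (\<sigma> a, \<sigma> b) \<in> parcs Y \<and> \<sigma> a = \<tau> b \<and> \<sigma> b = \<tau> a \<and>
       (\<forall>c \<in> pverts X - {a, b}. \<sigma> c = \<tau> c))"
  by (simp add: FS_def)

lemma pverts_FS: "pverts (FS X Y) = bijections (pverts X) (pverts Y)"
  by (simp add: FS_def)

text \<open>The arc relation of \<open>FS X Y\<close> is symmetric for symmetric \<open>Y\<close>, so directed walks describe
  connectedness (\<open>connected_FS_iff\<close> below); they are easier to map and to concatenate than walks
  in the symmetric closure.\<close>

definition FS_all_reachable :: "'a pair_pre_digraph \<Rightarrow> 'b pair_pre_digraph \<Rightarrow> bool" where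
  "FS_all_reachable X Y \<longleftrightarrow>
     (\<forall>\<sigma> \<in> bijections (pverts X) (pverts Y). \<forall>\<tau> \<in> bijections (pverts X) (pverts Y).
        (\<sigma>, \<tau>) \<in> (parcs (FS X Y))\<^sup>*)"

lemma connected_FS_iff:
  assumes "sym (parcs Y)"
  shows "connected (with_proj (FS X Y)) \<longleftrightarrow>
     bijections (pverts X) (pverts Y) \<noteq> {} \<and> FS_all_reachable X Y"
proof -
  have wf: "pair_wf_digraph (FS X Y)"
    by unfold_locales (auto simp: FS_def)
  interpret pair_wf_digraph "FS X Y" by (rule wf)
  have "sym (parcs (FS X Y))"
  proof (rule symI)
    fix \<sigma> \<tau> assume "(\<sigma>, \<tau>) \<in> parcs (FS X Y)"
    then show "(\<tau>, \<sigma>) \<in> parcs (FS X Y)"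
      unfolding FS_arc_iff using symD[OF assms] by metis
  qed
  then have "mk_symmetric (with_proj (FS X Y)) = FS X Y"
    by (intro pair_pre_digraph.equality) (auto simp: parcs_mk_symmetric dest: symD)
  moreover have "reachable (with_proj (FS X Y)) \<sigma> \<tau> \<longleftrightarrow> (\<sigma>, \<tau>) \<in> (parcs (FS X Y))\<^sup>*"
    if "\<sigma> \<in> pverts (FS X Y)" for \<sigma> \<tau>
  proof
    assume "(\<sigma>, \<tau>) \<in> (parcs (FS X Y))\<^sup>*"
    then have "\<tau> \<in> pverts (FS X Y)"
      using that by (cases rule: rtrancl.cases) (auto dest: in_arcsD2)
    then show "reachable (with_proj (FS X Y)) \<sigma> \<tau>"
      using that \<open>(\<sigma>, \<tau>) \<in> (parcs (FS X Y))\<^sup>*\<close> reachable_conv by blast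
  qed (use reachable_conv in blast)
  ultimately show ?thesis
    unfolding connected_def strongly_connected_def FS_all_reachable_def
    by (auto simp: pverts_FS)
qed

text \<open>A swap either leaves the occupant of position \<open>a\<close> alone or replaces it by one of its
  neighbours in \<open>Y\<close>.\<close>

lemma FS_walk_imp_walk_at_position:
  assumes "(\<sigma>, \<tau>) \<in> (parcs (FS X Y))\<^sup>*" "sym (parcs Y)" "a \<in> pverts X"
  shows "(\<sigma> a, \<tau> a) \<in> (parcs Y)\<^sup>*"
  using assms(1)
proof induction
  case base
  show ?case by simp
next
  case (step \<rho> \<tau>)
  then obtain u v where "(\<rho> u, \<rho> v) \<in> parcs Y" "\<rho> u = \<tau> v" "\<rho> v = \<tau> u"
    "\<forall>c \<in> pverts X - {u, v}. \<rho> c = \<tau> c"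
    unfolding FS_arc_iff by blast
  then have "\<rho> a = \<tau> a \<or> (\<rho> a, \<tau> a) \<in> parcs Y"
    using assms(3) symD[OF assms(2)] by (metis DiffI empty_iff insert_iff)
  then show ?case
    using step.IH by (metis rtrancl.rtrancl_into_rtrancl)
qed

text \<open>The people of \<open>K\<close>, standing on the copy \<open>h ` pverts X\<close> of \<open>X\<close> inside \<open>X'\<close>, can
  perform a walk of \<open>FS X K\<close> there while everybody else stays in place. With \<open>K = Y\<close> and an
  isomorphism \<open>h\<close> this transports connectedness from \<open>X\<close> to a copy with possibly more arcs;
  with \<open>h\<close> the identity and \<open>K = Y - y\<close> it rearranges everybody but \<open>y\<close>.\<close>

lemma FS_walk_on_copy:
  fixes X :: "'a pair_pre_digraph" and K Y :: "'b pair_pre_digraph" and X' :: "'c pair_pre_digraph"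
  assumes reach: "FS_all_reachable X K"
    and X: "pair_wf_digraph X"
    and h: "inj_on h (pverts X)" "h ` pverts X \<subseteq> pverts X'"
      "\<And>a b. (a, b) \<in> parcs X \<Longrightarrow> (h a, h b) \<in> parcs X'"
    and K: "parcs K \<subseteq> parcs Y"
    and \<sigma>: "\<sigma> \<in> bijections (pverts X') (pverts Y)" "\<sigma> ` h ` pverts X = pverts K"
    and \<tau>: "\<tau> \<in> bijections (pverts X') (pverts Y)" "\<tau> ` h ` pverts X = pverts K"
    and outside: "\<And>x. x \<in> pverts X' - h ` pverts X \<Longrightarrow> \<sigma> x = \<tau> x"
  shows "(\<sigma>, \<tau>) \<in> (parcs (FS X' Y))\<^sup>*"
proof -
  let ?V = "pverts X" and ?C = "h ` pverts X"
  (* pull reads off the arrangement on the copy; push \<rho> arranges the copy according to \<rho> and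
     leaves the rest as in \<sigma>, including the value undefined outside pverts X'. *)
  define pull where "pull \<rho> = restrict (\<rho> \<circ> h) ?V" for \<rho> :: "'c \<Rightarrow> 'b"
  define push where "push \<rho> = (\<lambda>x. if x \<in> ?C then \<rho> (inv_into ?V h x) else \<sigma> x)"
    for \<rho> :: "'a \<Rightarrow> 'b"
  have push_h: "push \<rho> (h a) = \<rho> a" if "a \<in> ?V" for \<rho> a
    using that h(1) by (simp add: push_def)
  have pull_bij: "pull \<rho> \<in> bijections ?V (pverts K)"
    if "\<rho> \<in> bijections (pverts X') (pverts Y)" "\<rho> ` ?C = pverts K" for \<rho>
  proof (rule bijectionsI)
    have "inj_on \<rho> ?C"
      using bijectionsD(1)[OF that(1)] h(2) by (meson bij_betw_def inj_on_subset)
    then have "bij_betw (\<rho> \<circ> h) ?V (pverts K)"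
      using h(1) that(2) by (metis bij_betw_def bij_betw_trans)
    then show "bij_betw (pull \<rho>) ?V (pverts K)"
      unfolding pull_def by (simp add: bij_betw_restrict_eq)
  qed (simp add: pull_def)
  have push_pull: "push (pull \<rho>) = \<rho>"
    if "\<rho> \<in> bijections (pverts X') (pverts Y)"
      "\<And>x. x \<in> pverts X' - ?C \<Longrightarrow> \<sigma> x = \<rho> x" for \<rho>
  proof
    fix x
    consider "x \<in> ?C" | "x \<in> pverts X' - ?C" | "x \<notin> pverts X'" "x \<notin> ?C"
      using h(2) by blast
    then show "push (pull \<rho>) x = \<rho> x"
    proof cases
      case 1
      then show ?thesis by (auto simp: push_h pull_def)
    next
      case 2
      then show ?thesis by (simp add: push_def that(2))
    next
      case 3
      then show ?thesis
        by (simp add: push_def bijectionsD(2)[OF that(1)] bijectionsD(2)[OF \<sigma>(1)])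
    qed
  qed
  have push_bij: "push \<rho> \<in> bijections (pverts X') (pverts Y)"
    if "\<rho> \<in> bijections ?V (pverts K)" for \<rho>
  proof (rule bijectionsI)
    have C: "bij_betw (push \<rho>) ?C (pverts K)"
    proof -
      have "bij_betw (\<rho> \<circ> inv_into ?V h) ?C (pverts K)"
        using bijectionsD(1)[OF that] h(1)
        by (meson bij_betw_trans bij_betw_inv_into inj_on_imp_bij_betw)
      then show ?thesis
        by (rule iffD1[OF bij_betw_cong, rotated]) (simp add: push_def)
    qed
    have \<sigma>b: "inj_on \<sigma> (pverts X')" "\<sigma> ` pverts X' = pverts Y"
      using bijectionsD(1)[OF \<sigma>(1)] by (auto simp: bij_betw_def)
    have "\<sigma> ` (pverts X' - ?C) = pverts Y - pverts K"
      using inj_on_image_set_diff[OF \<sigma>b(1) _ h(2)] \<sigma>b(2) \<sigma>(2) by (metis subset_refl Diff_subset)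
    moreover have "inj_on \<sigma> (pverts X' - ?C)"
      using \<sigma>b(1) by (rule inj_on_subset) blast
    ultimately have "bij_betw \<sigma> (pverts X' - ?C) (pverts Y - pverts K)"
      by (simp add: bij_betw_def)
    then have "bij_betw (push \<rho>) (pverts X' - ?C) (pverts Y - pverts K)"
      by (rule iffD1[OF bij_betw_cong, rotated]) (simp add: push_def)
    with C have "bij_betw (push \<rho>) (?C \<union> (pverts X' - ?C)) (pverts K \<union> (pverts Y - pverts K))"
      by (rule bij_betw_combine) blast
    moreover have "?C \<union> (pverts X' - ?C) = pverts X'" "pverts K \<union> (pverts Y - pverts K) = pverts Y"
      using h(2) \<sigma>b(2) \<sigma>(2) by blast+
    ultimately show "bij_betw (push \<rho>) (pverts X') (pverts Y)"
      by simp
    show "push \<rho> x = undefined" if "x \<notin> pverts X'" for x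
      using that h(2) bijectionsD(2)[OF \<sigma>(1)] by (auto simp: push_def)
  qed
  have push_arc: "(push \<rho>, push \<rho>') \<in> parcs (FS X' Y)"
    if "(\<rho>, \<rho>') \<in> parcs (FS X K)" for \<rho> \<rho>'
  proof -
    from that obtain a b where ab: "(a, b) \<in> parcs X" "(\<rho> a, \<rho> b) \<in> parcs K" "\<rho> a = \<rho>' b"
      "\<rho> b = \<rho>' a" "\<forall>c \<in> ?V - {a, b}. \<rho> c = \<rho>' c"
      and bij: "\<rho> \<in> bijections ?V (pverts K)" "\<rho>' \<in> bijections ?V (pverts K)"
      unfolding FS_arc_iff by blast
    have V: "a \<in> ?V" "b \<in> ?V"
      using ab(1) pair_wf_digraph.wellformed'[OF X] by blast+
    have "push \<rho> c = push \<rho>' c" if "c \<in> pverts X' - {h a, h b}" for c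
    proof (cases "c \<in> ?C")
      case True
      then obtain d where "d \<in> ?V" "c = h d" by blast
      then show ?thesis using that ab(5) by (auto simp: push_h)
    qed (simp add: push_def)
    then show ?thesis
      unfolding FS_arc_iff using ab(1-4) h(3) K V push_bij[OF bij(1)] push_bij[OF bij(2)]
      by (intro conjI exI[of _ "h a"] exI[of _ "h b"]) (auto simp: push_h)
  qed
  have "(pull \<sigma>, pull \<tau>) \<in> (parcs (FS X K))\<^sup>*"
    using reach pull_bij[OF \<sigma>] pull_bij[OF \<tau>] by (simp add: FS_all_reachable_def)
  then have "(push (pull \<sigma>), push (pull \<tau>)) \<in> (parcs (FS X' Y))\<^sup>*"
  proof induction
    case (step \<rho> \<rho>')
    then show ?case
      using push_arc by (meson rtrancl.rtrancl_into_rtrancl)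
  qed simp
  then show ?thesis
    using push_pull[OF \<sigma>(1)] push_pull[OF \<tau>(1) outside] by simp
qed

section \<open>Adding one position\<close>

definition pair_induce :: "'a pair_pre_digraph \<Rightarrow> 'a set \<Rightarrow> 'a pair_pre_digraph" where
  "pair_induce G S = \<lparr> pverts = S, parcs = parcs G \<inter> S \<times> S \<rparr>"

lemma pair_induce_simps [simp]:
  "pverts (pair_induce G S) = S" "parcs (pair_induce G S) = parcs G \<inter> S \<times> S"
  by (simp_all add: pair_induce_def)

lemma pair_wf_digraph_pair_induce: "pair_wf_digraph (pair_induce G S)"
  by unfold_locales auto

lemma pair_induce_all:
  assumes "pair_wf_digraph G"
  shows "pair_induce G (pverts G) = G"
  using pair_wf_digraph.wellformed'[OF assms]
  by (auto intro!: pair_pre_digraph.equality)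

lemma pair_graph_facts:
  assumes "pair_graph G"
  shows "pair_wf_digraph G" "sym (parcs G)" "finite (pverts G)" "\<And>a. (a, a) \<notin> parcs G"
proof -
  interpret pair_graph G by (rule assms)
  show "pair_wf_digraph G" by (rule pair_wf_digraph)
  show "sym (parcs G)" using arcs_symmetric by (blast intro: symI)
  show "finite (pverts G)" by (rule pair_finite_verts)
  show "(a, a) \<notin> parcs G" for a using no_loops' by blast
qed

lemma hereditary_class_pair_graph:
  assumes "hereditary_class \<H>" "G \<in> \<H>"
  shows "pair_graph G"
  using assms unfolding hereditary_class_def by blast

lemma hereditary_class_pair_induce:
  assumes "hereditary_class \<H>" "G \<in> \<H>" "S \<subseteq> pverts G"
  shows "pair_induce G S \<in> \<H>"
proof -
  have "pair_wf_digraph G"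
    using assms(1,2) by (intro pair_graph_facts(1) hereditary_class_pair_graph)
  then have "induced_subgraph (with_proj (pair_induce G S)) (with_proj G)"
    using assms(3) pair_wf_digraph_pair_induce[of G S]
    by (intro induced_subgraphI subgraphI) (auto simp: wf_digraph_wp_iff)
  then show ?thesis
    using assms(1,2) unfolding hereditary_class_def by blast
qed

text \<open>As \<open>X\<close> has at least two positions, \<open>y\<close> and \<open>z\<close> fit into an induced subgraph \<open>K\<close> of
  \<open>Y\<close> with as many vertices as \<open>X\<close>. Some walk in \<open>FS X K\<close> leads from an arrangement to the one
  with \<open>y\<close> and \<open>z\<close> exchanged, and the successive occupants of the original position of \<open>y\<close>
  form a walk from \<open>y\<close> to \<open>z\<close>.\<close>

lemma connected_if_induced_FS_reachable:
  assumes "\<And>S. S \<subseteq> pverts Y \<Longrightarrow> card S = card (pverts X) \<Longrightarrow> FS_all_reachable X (pair_induce Y S)"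
    and "finite (pverts X)" "2 \<le> card (pverts X)" "card (pverts X) \<le> card (pverts Y)"
    and "finite (pverts Y)" "sym (parcs Y)"
    and "y \<in> pverts Y" "z \<in> pverts Y"
  shows "(y, z) \<in> (parcs Y)\<^sup>*"
proof -
  have "card {y, z} \<le> card (pverts X)"
    using assms(3) by (simp add: card_insert_if)
  then obtain S where S: "{y, z} \<subseteq> S" "S \<subseteq> pverts Y" "card S = card (pverts X)"
    using exists_subset_between[of "{y, z}" "card (pverts X)" "pverts Y"] assms(4,5,7,8) by blast
  let ?K = "pair_induce Y S"
  have "finite S" using S(2) assms(5) finite_subset by blast
  then obtain \<sigma> where \<sigma>: "\<sigma> \<in> bijections (pverts X) S"
    using bijections_nonempty[OF assms(2), of S] S(3) by auto
  then have "\<sigma> ` pverts X = S"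
    by (meson bijectionsD(1) bij_betw_def)
  then obtain a b where ab: "a \<in> pverts X" "\<sigma> a = y" "b \<in> pverts X" "\<sigma> b = z"
    using S(1) by (metis imageE insert_subset)
  let ?\<tau> = "\<sigma> \<circ> transpose a b"
  (* Position a holds y in \<sigma> and z in ?\<tau>. *)
  have "(\<sigma>, ?\<tau>) \<in> (parcs (FS X ?K))\<^sup>*"
    using assms(1)[OF S(2,3)] \<sigma> bijections_comp_transpose[OF \<sigma> ab(1,3)]
    by (simp add: FS_all_reachable_def)
  moreover have "sym (parcs ?K)"
    using assms(6) by (auto intro!: symI dest: symD)
  ultimately have "(\<sigma> a, ?\<tau> a) \<in> (parcs ?K)\<^sup>*"
    using ab(1) by (rule FS_walk_imp_walk_at_position)
  then have "(y, z) \<in> (parcs ?K)\<^sup>*"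
    using ab by simp
  then show ?thesis
    using rtrancl_mono[of "parcs ?K" "parcs Y"] by auto
qed

text \<open>For fixed \<open>y\<close>, the bijections that put \<open>y\<close> at the new position \<open>w\<close> reach each other, because
  the old positions realise every rearrangement of \<open>Y\<close> without \<open>y\<close>. If \<open>y\<close> and \<open>z\<close> are adjacent
  in \<open>Y\<close>, one can first bring \<open>z\<close> to the neighbour \<open>v\<close> of \<open>w\<close> and then swap along
  \<open>(v, w)\<close>, so the occupant of \<open>w\<close> can be moved along any walk in \<open>Y\<close>; and \<open>Y\<close> is connected.\<close>

lemma FS_all_reachable_insert_position:
  assumes reach: "\<And>S. S \<subseteq> pverts Y \<Longrightarrow> card S = card (pverts X) \<Longrightarrow>
      FS_all_reachable X (pair_induce Y S)"
    and X: "pair_wf_digraph X" "finite (pverts X)" "2 \<le> card (pverts X)"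
    and Y: "pair_graph Y" "card (pverts Y) = Suc (card (pverts X))"
    and X': "pverts X' = insert w (pverts X)" "parcs X \<subseteq> parcs X'"
    and w: "w \<notin> pverts X" "v \<in> pverts X" "(v, w) \<in> parcs X'"
  shows "FS_all_reachable X' Y"
proof -
  note Y' = pair_graph_facts[OF Y(1)]
  let ?B = "bijections (pverts X') (pverts Y)" and ?W = "(parcs (FS X' Y))\<^sup>*"
  have same_at_w: "(\<sigma>, \<tau>) \<in> ?W" if "\<sigma> \<in> ?B" "\<tau> \<in> ?B" "\<sigma> w = \<tau> w" for \<sigma> \<tau>
  proof -
    let ?S = "pverts Y - {\<sigma> w}"
    have image: "\<rho> ` pverts X = pverts Y - {\<rho> w}" if "\<rho> \<in> ?B" for \<rho>
    proof -
      have "inj_on \<rho> (insert w (pverts X))" "\<rho> ` insert w (pverts X) = pverts Y"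
        using bijectionsD(1)[OF that] X'(1) by (auto simp: bij_betw_def)
      then have "pverts Y = insert (\<rho> w) (\<rho> ` pverts X)" "\<rho> w \<notin> \<rho> ` pverts X"
        using w(1) by (auto simp: inj_on_insert)
      then show ?thesis by simp
    qed
    have "\<sigma> w \<in> pverts Y"
      using bijectionsD(1)[OF that(1)] X'(1) by (auto dest: bij_betw_apply)
    then have "card ?S = card (pverts X)"
      using Y(2) Y'(3) by simp
    then have "FS_all_reachable X (pair_induce Y ?S)"
      by (intro reach) auto
    then show ?thesis
      by (rule FS_walk_on_copy[where h = "\<lambda>x. x"])
        (use that X(1) X' image[OF that(1)] image[OF that(2)] in auto)
  qed
  have to_adjacent: "\<exists>\<tau> \<in> ?B. \<tau> w = z \<and> (\<sigma>, \<tau>) \<in> ?W"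
    if \<sigma>: "\<sigma> \<in> ?B" and adj: "(\<sigma> w, z) \<in> parcs Y" for \<sigma> z
  proof -
    have "z \<in> pverts Y" "z \<noteq> \<sigma> w"
      using adj Y'(4) pair_wf_digraph.wellformed'(2)[OF Y'(1)] by auto
    then obtain u where u: "u \<in> pverts X'" "\<sigma> u = z" "u \<noteq> w"
      using bijectionsD(1)[OF \<sigma>] by (metis bij_betw_imp_surj_on imageE)
    (* ?\<rho> has z at v and still \<sigma> w at w, so the last swap is a legal one along (v, w). *)
    let ?\<rho> = "\<sigma> \<circ> transpose u v"
    let ?\<tau> = "?\<rho> \<circ> transpose v w"
    have vw: "v \<in> pverts X'" "w \<in> pverts X'" "v \<noteq> w"
      using X'(1) w by auto
    have \<rho>: "?\<rho> \<in> ?B" "?\<rho> w = \<sigma> w" "?\<rho> v = z"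
      using bijections_comp_transpose[OF \<sigma> u(1) vw(1)] u vw(3) by (auto simp: transpose_def)
    have \<tau>: "?\<tau> \<in> ?B" "?\<tau> w = z"
      using bijections_comp_transpose[OF \<rho>(1) vw(1,2)] \<rho>(3) by auto
    have "(?\<rho> v, ?\<rho> w) \<in> parcs Y"
      using \<rho>(2,3) adj Y'(2) by (auto dest: symD)
    then have "(?\<rho>, ?\<tau>) \<in> parcs (FS X' Y)"
      unfolding FS_arc_iff using \<rho>(1) \<tau>(1) w(3)
      by (intro conjI exI[of _ v] exI[of _ w]) (auto simp: transpose_def)
    moreover have "(\<sigma>, ?\<rho>) \<in> ?W"
      using same_at_w \<sigma> \<rho> by simp
    ultimately have "(\<sigma>, ?\<tau>) \<in> ?W"
      by (rule rtrancl_into_rtrancl[rotated])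
    with \<tau> show ?thesis by blast
  qed
  have to_reachable: "\<exists>\<tau> \<in> ?B. \<tau> w = z \<and> (\<sigma>, \<tau>) \<in> ?W"
    if "\<sigma> \<in> ?B" "(\<sigma> w, z) \<in> (parcs Y)\<^sup>*" for \<sigma> z
    using that(2)
  proof induction
    case base
    then show ?case using that(1) by blast
  next
    case (step y z)
    then obtain \<rho> where "\<rho> \<in> ?B" "\<rho> w = y" "(\<sigma>, \<rho>) \<in> ?W" by blast
    with to_adjacent[of \<rho> z] step(2) show ?case
      by (meson rtrancl_trans)
  qed
  have "(\<sigma>, \<tau>) \<in> ?W" if "\<sigma> \<in> ?B" "\<tau> \<in> ?B" for \<sigma> \<tau>
  proof -
    have "\<sigma> w \<in> pverts Y" "\<tau> w \<in> pverts Y"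
      using that X'(1) by (auto dest!: bijectionsD(1) bij_betw_apply)
    then have "(\<sigma> w, \<tau> w) \<in> (parcs Y)\<^sup>*"
      using connected_if_induced_FS_reachable[OF reach X(2,3)] Y(2) Y'(2,3) by simp
    then obtain \<rho> where "\<rho> \<in> ?B" "\<rho> w = \<tau> w" "(\<sigma>, \<rho>) \<in> ?W"
      using to_reachable[OF \<open>\<sigma> \<in> ?B\<close>] by blast
    then show ?thesis
      using same_at_w \<open>\<tau> \<in> ?B\<close> by (meson rtrancl_trans)
  qed
  then show ?thesis
    by (simp add: FS_all_reachable_def)
qed

section \<open>Growing the set of positions\<close>

text \<open>An isomorphism carries its own map on arcs; since arcs of a pair graph are the pairs of their
  ends, that map is determined by the map on vertices.\<close>

lemma digraph_iso_with_projE: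
  assumes "digraph_iso (with_proj G) (with_proj H)"
  obtains h where "bij_betw h (pverts G) (pverts H)" "parcs H = map_prod h h ` parcs G"
proof -
  obtain f where iso: "pre_digraph.digraph_isomorphism (with_proj G) f"
    and H: "with_proj H = app_iso f (with_proj G)"
    using assms unfolding digraph_iso_def by blast
  let ?h = "iso_verts f"
  have verts: "pverts H = ?h ` pverts G" and arcs: "parcs H = iso_arcs f ` parcs G"
    and ends: "iso_tail f = fst" "iso_head f = snd"
    using arg_cong[OF H, of verts] arg_cong[OF H, of arcs]
      arg_cong[OF H, of tail] arg_cong[OF H, of head] by simp_all
  have "iso_arcs f e = map_prod ?h ?h e" if "e \<in> parcs G" for e
    using iso that ends unfolding pre_digraph.digraph_isomorphism_def
    by (auto simp: prod_eq_iff map_prod_def split: prod.splits)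
  then have "parcs H = map_prod ?h ?h ` parcs G"
    unfolding arcs by (rule image_cong[OF refl])
  moreover have "bij_betw ?h (pverts G) (pverts H)"
    using iso verts unfolding pre_digraph.digraph_isomorphism_def by (simp add: bij_betw_def)
  ultimately show thesis using that by blast
qed

text \<open>A Hamiltonian path visits vertices inside and outside of \<open>S\<close>, so somewhere two consecutive
  vertices of it lie on different sides.\<close>

lemma hamiltonian_path_imp_crossing_arc:
  assumes path: "hamiltonian_path P G"
    and G: "sym (parcs G)" "finite (pverts G)"
    and S: "S \<subset> pverts G" "S \<noteq> {}"
  obtains v w where "v \<in> S" "w \<in> pverts G - S" "(v, w) \<in> parcs G"
proof -
  let ?n = "card (pverts G)"
  have sub: "pverts P \<subseteq> pverts G" "parcs P \<subseteq> parcs G" "pair_wf_digraph P"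
    using path unfolding hamiltonian_path_def by (auto simp: subgraph_def wf_digraph_wp_iff)
  obtain h where h: "bij_betw h (pverts P) {..<?n}"
    and arcs: "parcs (path_graph ?n) = map_prod h h ` parcs P"
    using path unfolding hamiltonian_path_def
    by (auto elim!: digraph_iso_with_projE simp: path_graph_def)
  have "pverts P = pverts G"
    using sub(1) G(2) bij_betw_same_card[OF h] by (simp add: card_subset_eq)
  define g where "g = inv_into (pverts G) h"
  have g_h: "g (h a) = a" if "a \<in> pverts G" for a
    unfolding g_def using h that \<open>pverts P = pverts G\<close> by (simp add: bij_betw_def)
  have consecutive: "(g i, g (Suc i)) \<in> parcs G \<and> g i \<in> pverts G \<and> g (Suc i) \<in> pverts G"
    if "Suc i < ?n" for i
  proof -
    have "(i, Suc i) \<in> map_prod h h ` parcs P"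
      using that unfolding arcs[symmetric] by (simp add: path_graph_def)
    then obtain a b where "(a, b) \<in> parcs P" "h a = i" "h b = Suc i" by auto
    moreover from this have "a \<in> pverts G" "b \<in> pverts G"
      using pair_wf_digraph.wellformed'[OF sub(3)] sub(1) by blast+
    ultimately show ?thesis using sub(2) g_h by (metis subsetD)
  qed
  (* Without a crossing arc, all vertices of the path lie on the same side of S. *)
  have "\<exists>v \<in> S. \<exists>w \<in> pverts G - S. (v, w) \<in> parcs G"
  proof (rule ccontr)
    assume none: "\<not> ?thesis"
    have step: "g i \<in> S \<longleftrightarrow> g (Suc i) \<in> S" if "Suc i < ?n" for i
      using consecutive[OF that] none symD[OF G(1)] by blast
    have all: "i < ?n \<Longrightarrow> g i \<in> S \<longleftrightarrow> g 0 \<in> S" for i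
      by (induction i) (use step in auto)
    obtain p q where "p \<in> S" "p \<in> pverts G" "q \<in> pverts G" "q \<notin> S"
      using S by blast
    moreover have "a \<in> S \<longleftrightarrow> g 0 \<in> S" if "a \<in> pverts G" for a
      using all[of "h a"] g_h[OF that] bij_betw_apply[OF h, of a] that \<open>pverts P = pverts G\<close>
      by auto
    ultimately show False by blast
  qed
  then show thesis using that by blast
qed

text \<open>Induction on the number of positions outside \<open>S\<close>; the property of \<open>S\<close> has to range over
  the whole class, because the growth step applies it to induced subgraphs of \<open>Y\<close>.\<close>

lemma FS_all_reachable_grow:
  assumes \<H>: "hereditary_class \<H>"
    and G: "pair_graph G" "hamiltonian_path P G"
    and S: "S \<subseteq> pverts G" "2 \<le> card S"
    and reach: "\<And>Y. Y \<in> \<H> \<Longrightarrow> card (pverts Y) = card S \<Longrightarrow> FS_all_reachable (pair_induce G S) Y"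
    and Y: "Y \<in> \<H>" "card (pverts Y) = card (pverts G)"
  shows "FS_all_reachable G Y"
  using S reach
proof (induction "card (pverts G - S)" arbitrary: S)
  note G' = pair_graph_facts[OF G(1)]
  case 0
  then have "S = pverts G"
    using G'(3) by auto
  then show ?case
    using 0(4)[OF Y(1)] Y(2) pair_induce_all[OF G'(1)] by simp
next
  note G' = pair_graph_facts[OF G(1)]
  case (Suc k)
  have "S \<subset> pverts G"
    using Suc(2) Suc.prems(1) by auto
  then obtain v w where vw: "v \<in> S" "w \<in> pverts G - S" "(v, w) \<in> parcs G"
    using hamiltonian_path_imp_crossing_arc[OF G(2) G'(2,3), of S] Suc.prems(2) by force
  have fin: "finite S"
    using Suc.prems(1) G'(3) by (rule finite_subset)
  show ?case
  proof (rule Suc(1))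
    have "pverts G - insert w S = (pverts G - S) - {w}" by blast
    then show "k = card (pverts G - insert w S)"
      using Suc(2) vw(2) G'(3) by simp
    show "insert w S \<subseteq> pverts G" "2 \<le> card (insert w S)"
      using Suc.prems(1,2) vw(2) fin by auto
    show "FS_all_reachable (pair_induce G (insert w S)) Z"
      if Z: "Z \<in> \<H>" "card (pverts Z) = card (insert w S)" for Z
    proof (rule FS_all_reachable_insert_position[where X = "pair_induce G S" and v = v and w = w])
      show "FS_all_reachable (pair_induce G S) (pair_induce Z T)"
        if "T \<subseteq> pverts Z" "card T = card (pverts (pair_induce G S))" for T
        using that Suc.prems(3)[OF hereditary_class_pair_induce[OF \<H> Z(1) that(1)]] by simp
      show "pair_graph Z"
        using \<H> Z(1) by (rule hereditary_class_pair_graph)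
    qed (use Z(2) fin vw Suc.prems(2) pair_wf_digraph_pair_induce in auto)
  qed
qed

theorem corollary5p3:
  fixes \<H> :: "'b pair_pre_digraph set"
    and X :: "'a pair_pre_digraph"
    and Xt :: "'c pair_pre_digraph"
    and n\<^sub>0 n :: nat
  assumes "hereditary_class \<H>"
    and "pair_graph X"
    and "card (pverts X) = n\<^sub>0"
    and "n\<^sub>0 \<ge> 2"
    and "\<exists>P. hamiltonian_path P X"
    and "\<And>Y. Y \<in> \<H> \<Longrightarrow> card (pverts Y) = n\<^sub>0 \<Longrightarrow> connected (with_proj (FS X Y))"
    and "prolongation X Xt"
    and "card (pverts Xt) = n"
  shows "\<forall>Yt \<in> \<H>. card (pverts Yt) = n \<longrightarrow> connected (with_proj (FS Xt Yt))"
proof (intro ballI impI)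
  fix Yt assume Yt: "Yt \<in> \<H>" "card (pverts Yt) = n"
  have graph: "pair_graph Y" if "Y \<in> \<H>" for Y
    using assms(1) that by (rule hereditary_class_pair_graph)
  obtain Xs P where Xt: "pair_graph Xt" "hamiltonian_path P Xt"
    and Xs: "pverts Xs \<subseteq> pverts Xt" "parcs Xs \<subseteq> parcs Xt"
    and iso: "digraph_iso (with_proj X) (with_proj Xs)"
    using assms(7) unfolding prolongation_def by (auto simp: subgraph_def)
  obtain h where h: "bij_betw h (pverts X) (pverts Xs)" "parcs Xs = map_prod h h ` parcs X"
    using iso by (rule digraph_iso_with_projE)
  let ?S = "pverts Xs"
  have card_S: "card ?S = n\<^sub>0"
    using bij_betw_same_card[OF h(1)] assms(3) by simp
  have X_wf: "pair_wf_digraph X"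
    by (rule pair_graph_facts(1)[OF assms(2)])
  have "FS_all_reachable (pair_induce Xt ?S) Y" if Y: "Y \<in> \<H>" "card (pverts Y) = card ?S" for Y
  proof -
    have "FS_all_reachable X Y"
      using assms(6)[OF Y(1)] Y(2) card_S connected_FS_iff pair_graph_facts(2)[OF graph[OF Y(1)]]
      by blast
    moreover have "h ` pverts X = ?S" "inj_on h (pverts X)"
      using h(1) by (auto simp: bij_betw_def)
    moreover have "(h a, h b) \<in> parcs (pair_induce Xt ?S)" if "(a, b) \<in> parcs X" for a b
    proof -
      have "a \<in> pverts X" "b \<in> pverts X"
        using that pair_wf_digraph.wellformed'[OF X_wf] by blast+
      moreover have "(h a, h b) \<in> parcs Xs"
        unfolding h(2) using that by (auto intro: rev_image_eqI)
      ultimately show ?thesis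
        using Xs(2) \<open>h ` pverts X = ?S\<close> by auto
    qed
    ultimately have "(\<sigma>, \<tau>) \<in> (parcs (FS (pair_induce Xt ?S) Y))\<^sup>*"
      if "\<sigma> \<in> bijections ?S (pverts Y)" "\<tau> \<in> bijections ?S (pverts Y)" for \<sigma> \<tau>
      by (intro FS_walk_on_copy[where X = X and K = Y and h = h])
        (use that X_wf in \<open>auto dest!: bijectionsD(1) bij_betw_imp_surj_on\<close>)
    then show ?thesis
      by (simp add: FS_all_reachable_def)
  qed
  then have "FS_all_reachable Xt Yt"
    using FS_all_reachable_grow[OF assms(1) Xt Xs(1)] card_S assms(4,8) Yt by simp
  moreover have "bijections (pverts Xt) (pverts Yt) \<noteq> {}"
    using bijections_nonempty pair_graph_facts(3) Xt(1) graph[OF Yt(1)] Yt(2) assms(8) by metis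
  ultimately show "connected (with_proj (FS Xt Yt))"
    using connected_FS_iff pair_graph_facts(2)[OF graph[OF Yt(1)]] by blast
qed

end
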